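(* Let $M\in\mathbb{N}$, $M\ge 1$, and let $\phi(t)=\psi_0t^{a_0}+o(t^{a_0})\in\mathbb{C}\{t\}$ with $a_0\in\mathbb{N}$, $a_0\ge1$, and $\psi_0\in i(0,\infty)$. Set $$G_\phi(t)=|t|^{2M}-\Im(\phi(t)).$$ (a) If $G_\phi(t)\ge 0$ for all $t\in\mathbb{C}$ with $|t|$ small, then $a_0\ge 2M$. If in addition $a_0=2M$, then $|\psi_0|\le 1$. (b) Conversely, if $a_0>2M$, or if $a_0=2M$ and $|\psi_0|<1$, then $G_\phi(t)\ge 0$ for all $t\in\mathbb{C}$ with $|t|$ small, and $w-\phi(z^{1/M})$ is comparable to $w$ for $(z,w)\in U_2$ near $(0,0)$.
   Context: $\mathbb{C}\{t\}$ is the ring of convergent power series in $t$ centered at $0$. $U_2=\{(z,w)\in\mathbb{C}^2:\Im w>|z|^2\}$. The comparability statement means: there exist constants $0<c_1\le c_2$ and $\epsilon>0$ such that $c_1|w|\le|w-\phi(\zeta)|\le c_2|w|$ for all $(z,w)\in U_2$ with $|(z,w)|<\epsilon$ and every $M$-th root $\zeta$ of $z$ (i.e. $\zeta^M=z$, any branch of $z^{1/M}$). *)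

theory Defs
  imports
    "HOL-Analysis.Analysis"
    "HOL-Analysis.FPS_Convergence"
    "HOL-Library.Landau_Symbols"
begin

text \<open>
  An element of the ring of convergent power series centred at 0 is a formal power series
  of positive radius of convergence.
\<close>
definition convergent_power_series :: "complex fps set" where
  "convergent_power_series = {\<phi>. fps_conv_radius \<phi> > 0}"

text \<open>
  Outside the disc of convergence \<^const>\<open>eval_fps\<close> may take junk values;
  \<open>G\<close> and \<open>comparable_root_graph\<close> below are only used near the origin.
\<close>
definition G :: "nat \<Rightarrow> complex fps \<Rightarrow> complex \<Rightarrow> real" where
  "G M \<phi> t = norm t ^ (2 * M) - Im (eval_fps \<phi> t)"

definition U2 :: "(complex \<times> complex) set" where
  "U2 = {(z, w). Im w > (norm z)\<^sup>2}"

text \<open>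
  Comparability of \<open>w - \<phi>(z\<^sup>1\<^sup>/\<^sup>M)\<close> with \<open>w\<close> on \<open>U2\<close> near the origin. The \<open>M\<close>-th root is
  multivalued: the constants are uniform over all \<open>\<zeta>\<close> with \<open>\<zeta> ^ M = z\<close>.
\<close>
definition comparable_root_graph :: "nat \<Rightarrow> complex fps \<Rightarrow> bool" where
  "comparable_root_graph M \<phi> \<longleftrightarrow>
     (\<exists>c\<^sub>1 c\<^sub>2 \<epsilon> :: real. 0 < c\<^sub>1 \<and> c\<^sub>1 \<le> c\<^sub>2 \<and> 0 < \<epsilon> \<and>
       (\<forall>z w \<zeta>. (z, w) \<in> U2 \<longrightarrow> norm (z, w) < \<epsilon> \<longrightarrow> \<zeta> ^ M = z \<longrightarrow>
          c\<^sub>1 * norm w \<le> norm (w - eval_fps \<phi> \<zeta>) \<and>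
          norm (w - eval_fps \<phi> \<zeta>) \<le> c\<^sub>2 * norm w))"

end

theory Submission
  imports Defs
begin

text \<open>
  On the positive real axis \<open>Im \<phi>(s) \<approx> |\<psi>\<^sub>0| s\<^sup>a\<close>, so \<open>G \<ge> 0\<close> forces
  \<open>(|\<psi>\<^sub>0| - \<epsilon>) s\<^sup>a \<le> s\<^sup>2\<^sup>M\<close> for small \<open>s > 0\<close>, which gives (a).
  For (b), the hypotheses yield \<open>|\<phi>(t)| \<le> k |t|\<^sup>2\<^sup>M\<close> near \<open>0\<close> with some \<open>k < 1\<close>; for
  \<open>\<zeta>\<^sup>M = z\<close> and \<open>(z, w) \<in> U\<^sub>2\<close> this reads \<open>|\<phi>(\<zeta>)| \<le> k |z|\<^sup>2 \<le> k |w|\<close>.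
\<close>

text \<open>The filter \<open>at 0\<close> omits the origin, so the asymptotics alone leave
  \<open>eval_fps \<phi> 0\<close> open. They do force the limit there to be 0, and continuity
  inside the disc of convergence turns this limit into the value.\<close>

lemma eval_fps_zero_of_asymp:
  fixes \<phi> :: "complex fps"
  assumes "fps_conv_radius \<phi> > 0" and "a \<ge> 1"
    and "(\<lambda>t. eval_fps \<phi> t - \<psi> * t ^ a) \<in> o[at 0](\<lambda>t. t ^ a)"
  shows "eval_fps \<phi> 0 = 0"
proof -
  have pow: "((\<lambda>t::complex. t ^ a) \<longlongrightarrow> 0) (at 0)"
    using assms(2) by (auto intro!: tendsto_eq_intros simp: power_0_left)
  have "((\<lambda>t. eval_fps \<phi> t - \<psi> * t ^ a) \<longlongrightarrow> 0) (at 0)"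
  proof (rule Lim_null_comparison[OF _ tendsto_norm_zero[OF pow]])
    show "\<forall>\<^sub>F t in at 0. norm (eval_fps \<phi> t - \<psi> * t ^ a) \<le> norm (t ^ a)"
      using landau_o.smallD[OF assms(3), of 1] by simp
  qed
  from tendsto_add[OF this tendsto_mult_right_zero[OF pow, of \<psi>]]
  have lim: "(eval_fps \<phi> \<longlongrightarrow> 0) (at 0)" by simp
  have "isCont (eval_fps \<phi>) 0"
    by (rule continuous_on_interior[OF continuous_on_eval_fps])
      (use assms(1) in \<open>simp add: zero_ereal_def interior_open\<close>)
  then have "(eval_fps \<phi> \<longlongrightarrow> eval_fps \<phi> 0) (at 0)"
    by (simp add: isCont_def)
  with lim show ?thesis
    using LIM_unique by blast
qed

lemma asymp_order_bound:
  fixes f :: "complex \<Rightarrow> complex"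
  assumes o: "(\<lambda>t. f t - \<psi> * t ^ a) \<in> o[at 0](\<lambda>t. t ^ a)"
    and Im: "Im \<psi> > 0"
    and nonneg: "\<forall>\<^sub>F t in nhds 0. Im (f t) \<le> norm t ^ n"
  shows "a \<ge> n \<and> (a = n \<longrightarrow> Im \<psi> \<le> 1)"
proof -
  \<comment> \<open>Restricting to t = s > 0 makes \<open>t ^ a\<close> real, so the imaginary part
    of the leading term is exactly \<open>Im \<psi> * s ^ a\<close>. The error constant c stays
    free: the order bound takes \<open>Im \<psi> / 2\<close>, the coefficient bound takes every c >
    0.\<close>
  have key: "\<forall>\<^sub>F s in at_right (0::real). (Im \<psi> - c) * s ^ a \<le> s ^ n" if "c > 0" for c
  proof -
    have "\<forall>\<^sub>F t in at 0. norm (f t - \<psi> * t ^ a) \<le> c * norm (t ^ a) \<and> Im (f t) \<le> norm t ^ n"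
      using landau_o.smallD[OF o that] nonneg
      by (auto simp: eventually_conj_iff eventually_at_filter elim: eventually_mono)
    moreover have "filterlim complex_of_real (at 0) (at_right 0)"
      by (auto simp: filterlim_at eventually_at_filter intro!: tendsto_eq_intros)
    ultimately have "\<forall>\<^sub>F s in at_right 0.
        norm (f (of_real s) - \<psi> * of_real s ^ a) \<le> c * norm (complex_of_real s ^ a) \<and>
        Im (f (of_real s)) \<le> norm (complex_of_real s) ^ n"
      by (rule eventually_compose_filterlim)
    with eventually_at_right_less[of 0] show ?thesis
    proof eventually_elim
      case (elim s)
      have "\<bar>Im (f (of_real s) - \<psi> * of_real s ^ a)\<bar> \<le> c * s ^ a"
        using elim abs_Im_le_cmod[of "f (of_real s) - \<psi> * of_real s ^ a"]
        by (simp add: norm_power)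
      moreover have "Im (\<psi> * complex_of_real s ^ a) = Im \<psi> * s ^ a"
        by (simp flip: of_real_power)
      ultimately show ?case
        using elim by (simp add: abs_le_iff algebra_simps)
    qed
  qed
  have "a \<ge> n"
  proof (rule ccontr)
    \<comment> \<open>If a < n, dividing by \<open>s ^ a\<close> would leave
      \<open>Im \<psi> / 2 \<le> s ^ (n - a)\<close>, whose right side tends to 0. The contradiction
      holds eventually, and \<open>at_right 0\<close> is a nontrivial filter.\<close>
    assume "\<not> n \<le> a"
    then have "((\<lambda>s::real. s ^ (n - a)) \<longlongrightarrow> 0) (at_right 0)"
      by (auto intro!: tendsto_eq_intros simp: power_0_left)
    then have "\<forall>\<^sub>F s in at_right (0::real). s ^ (n - a) < Im \<psi> / 2"
      using Im by (intro order_tendstoD) auto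
    with key[OF half_gt_zero[OF Im]] eventually_at_right_less[of 0]
    have "\<forall>\<^sub>F s in at_right (0::real). False"
    proof eventually_elim
      case (elim s)
      have "s ^ n = s ^ (n - a) * s ^ a"
        using \<open>\<not> n \<le> a\<close> by (simp flip: power_add)
      also have "\<dots> < Im \<psi> / 2 * s ^ a"
        using elim by (intro mult_strict_right_mono) auto
      finally show ?case
        using elim by (simp add: algebra_simps)
    qed
    then show False by simp
  qed
  moreover have "Im \<psi> \<le> 1" if "a = n"
  proof (rule field_le_epsilon)
    fix c :: real assume "c > 0"
    \<comment> \<open>With a = n the factor \<open>s ^ a\<close> cancels, leaving an inequality free
      of s.\<close>
    from key[OF this] eventually_at_right_less[of 0]
    have "\<forall>\<^sub>F s in at_right (0::real). Im \<psi> \<le> 1 + c"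
      by eventually_elim (use that in \<open>simp add: mult_le_cancel_right1\<close>)
    then show "Im \<psi> \<le> 1 + c" by simp
  qed
  ultimately show ?thesis by blast
qed

text \<open>Both alternatives leave room for a factor below 1: a surplus power of
  \<open>norm t\<close> swallows any constant, while at equal order the gap between
  \<open>norm \<psi>\<close> and 1 absorbs the error term.\<close>

lemma asymp_norm_bound:
  fixes f :: "'a::real_normed_field \<Rightarrow> 'a"
  assumes o: "(\<lambda>t. f t - \<psi> * t ^ a) \<in> o[at 0](\<lambda>t. t ^ a)"
    and "f 0 = 0"
    and "a > n \<or> (a = n \<and> norm \<psi> < 1)"
  obtains k where "0 \<le> k" "k < 1" "\<forall>\<^sub>F t in nhds 0. norm (f t) \<le> k * norm t ^ n"
proof -
  have ev: "\<forall>\<^sub>F t in nhds 0. norm (f t) \<le> (norm \<psi> + c) * norm t ^ a" if "c > 0" for c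
  proof -
    have "\<forall>\<^sub>F t in at 0. norm (f t) \<le> (norm \<psi> + c) * norm t ^ a"
      using landau_o.smallD[OF o that]
    proof eventually_elim
      case (elim t)
      have "norm (f t) \<le> norm (f t - \<psi> * t ^ a) + norm (\<psi> * t ^ a)"
        by (metis diff_add_cancel norm_triangle_ineq)
      with elim show ?case
        by (simp add: norm_mult norm_power algebra_simps)
    qed
    \<comment> \<open>The value at 0 extends the bound from the punctured neighbourhood to a full
      one, so that the origin is covered too.\<close>
    with that \<open>f 0 = 0\<close> show ?thesis
      by (simp add: eventually_nhds_conv_at)
  qed
  from assms(3) consider "a > n" | "a = n" "norm \<psi> < 1" by blast
  then show ?thesis
  proof cases
    case 1
    have "((\<lambda>t::'a. (norm \<psi> + 1) * norm t ^ (a - n)) \<longlongrightarrow> 0) (nhds 0)"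
      using 1 by (auto intro!: tendsto_eq_intros filterlim_ident simp: power_0_left)
    then have "\<forall>\<^sub>F t::'a in nhds 0. (norm \<psi> + 1) * norm t ^ (a - n) < 1 / 2"
      by (rule order_tendstoD) simp
    with ev[of 1, simplified] have "\<forall>\<^sub>F t in nhds 0. norm (f t) \<le> 1 / 2 * norm t ^ n"
    proof eventually_elim
      case (elim t)
      have "norm (f t) \<le> (norm \<psi> + 1) * norm t ^ (a - n) * norm t ^ n"
        using elim(1) 1 by (simp add: mult.assoc flip: power_add)
      also have "\<dots> \<le> 1 / 2 * norm t ^ n"
        using elim(2) by (intro mult_right_mono) auto
      finally show ?case .
    qed
    then show ?thesis by (intro that[of "1 / 2"]) auto
  next
    case 2
    \<comment> \<open>Spending half of the gap on the error gives k = (1 +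
      \<open>norm \<psi>\<close>) / 2, which is still below 1.\<close>
    have "\<forall>\<^sub>F t in nhds 0. norm (f t) \<le> (norm \<psi> + (1 - norm \<psi>) / 2) * norm t ^ n"
      using ev[of "(1 - norm \<psi>) / 2"] 2 by simp
    moreover have "norm \<psi> + (1 - norm \<psi>) / 2 < 1"
      using 2 by (simp add: field_simps)
    ultimately show ?thesis
      using 2 by (intro that) auto
  qed
qed

lemma comparable_root_graphI:
  assumes "0 \<le> k" "k < 1"
    and "\<forall>\<^sub>F t in nhds 0. norm (eval_fps \<phi> t) \<le> k * norm t ^ (2 * M)"
  shows "comparable_root_graph M \<phi>"
proof -
  obtain d where d: "d > 0" "\<And>t. norm t < d \<Longrightarrow> norm (eval_fps \<phi> t) \<le> k * norm t ^ (2 * M)"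
    using assms(3) by (auto simp: eventually_nhds_metric)
  \<comment> \<open>The radius \<open>d ^ M\<close> serves all branches at once: every root
    satisfies \<open>norm \<zeta> ^ M = norm z < d ^ M\<close>, hence
    \<open>norm \<zeta> < d\<close>. The constants 1 - k and 1 + k come from the triangle
    inequality.\<close>
  have "(1 - k) * norm w \<le> norm (w - eval_fps \<phi> \<zeta>) \<and>
      norm (w - eval_fps \<phi> \<zeta>) \<le> (1 + k) * norm w"
    if "(z, w) \<in> U2" "norm (z, w) < d ^ M" "\<zeta> ^ M = z" for z w \<zeta>
  proof -
    have "norm \<zeta> ^ M = norm z"
      using that(3) by (simp flip: norm_power)
    also have "\<dots> < d ^ M"
      using norm_fst_le[of z w] that(2) by simp
    finally have "norm \<zeta> < d"
      using d(1) by (auto intro: power_less_imp_less_base)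
    from d(2)[OF this] have "norm (eval_fps \<phi> \<zeta>) \<le> k * (norm z)\<^sup>2"
      using that(3) by (simp add: mult.commute[of 2] power_mult flip: norm_power)
    also have "\<dots> \<le> k * norm w"
      using that(1) abs_Im_le_cmod[of w] assms(1) by (intro mult_left_mono) (auto simp: U2_def)
    finally show ?thesis
      using norm_triangle_ineq2[of w "eval_fps \<phi> \<zeta>"] norm_triangle_ineq4[of w "eval_fps \<phi> \<zeta>"]
      by (simp add: algebra_simps)
  qed
  moreover have "0 < 1 - k" "1 - k \<le> 1 + k" "0 < d ^ M"
    using assms d(1) by auto
  ultimately show ?thesis
    unfolding comparable_root_graph_def by blast
qed

theorem proposition1p3:
  fixes M a\<^sub>0 :: nat and \<phi> :: "complex fps" and \<psi>\<^sub>0 :: complex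
  assumes "M \<ge> 1" and "a\<^sub>0 \<ge> 1"
    and "\<phi> \<in> convergent_power_series"
    and "\<psi>\<^sub>0 \<in> {\<i> * complex_of_real r | r. r > 0}"
    and "(\<lambda>t. eval_fps \<phi> t - \<psi>\<^sub>0 * t ^ a\<^sub>0) \<in> o[at 0](\<lambda>t. t ^ a\<^sub>0)"
  shows "((\<forall>\<^sub>F t in nhds 0. G M \<phi> t \<ge> 0) \<longrightarrow>
            a\<^sub>0 \<ge> 2 * M \<and> (a\<^sub>0 = 2 * M \<longrightarrow> norm \<psi>\<^sub>0 \<le> 1))
       \<and> (a\<^sub>0 > 2 * M \<or> (a\<^sub>0 = 2 * M \<and> norm \<psi>\<^sub>0 < 1) \<longrightarrow>
            (\<forall>\<^sub>F t in nhds 0. G M \<phi> t \<ge> 0) \<and> comparable_root_graph M \<phi>)"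
proof (intro conjI[of "_ \<longrightarrow> _"] impI)
  \<comment> \<open>As \<open>\<psi>\<^sub>0\<close> lies on the positive imaginary axis, its
    modulus is its imaginary part, so a bound on the latter is a bound on the modulus.\<close>
  have Im: "Im \<psi>\<^sub>0 > 0" "norm \<psi>\<^sub>0 = Im \<psi>\<^sub>0"
    using assms(4) by (auto simp: norm_mult)
  assume "\<forall>\<^sub>F t in nhds 0. G M \<phi> t \<ge> 0"
  then have "\<forall>\<^sub>F t in nhds 0. Im (eval_fps \<phi> t) \<le> norm t ^ (2 * M)"
    by (simp add: G_def)
  from asymp_order_bound[OF assms(5) Im(1) this]
  show "a\<^sub>0 \<ge> 2 * M \<and> (a\<^sub>0 = 2 * M \<longrightarrow> norm \<psi>\<^sub>0 \<le> 1)"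
    by (simp add: Im(2))
next
  assume "a\<^sub>0 > 2 * M \<or> (a\<^sub>0 = 2 * M \<and> norm \<psi>\<^sub>0 < 1)"
  moreover have "eval_fps \<phi> 0 = 0"
    using eval_fps_zero_of_asymp assms(2,3,5) by (auto simp: convergent_power_series_def)
  ultimately obtain k where k: "0 \<le> k" "k < 1"
    "\<forall>\<^sub>F t in nhds 0. norm (eval_fps \<phi> t) \<le> k * norm t ^ (2 * M)"
    using asymp_norm_bound[OF assms(5)] by blast
  from k(3) have "\<forall>\<^sub>F t in nhds 0. G M \<phi> t \<ge> 0"
  proof eventually_elim
    case (elim t)
    have "Im (eval_fps \<phi> t) \<le> norm (eval_fps \<phi> t)"
      using abs_Im_le_cmod[of "eval_fps \<phi> t"] by linarith
    also have "\<dots> \<le> k * norm t ^ (2 * M)" by (fact elim)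
    also have "\<dots> \<le> norm t ^ (2 * M)"
      using k by (intro mult_left_le_one_le) auto
    finally show ?case by (simp add: G_def)
  qed
  then show "(\<forall>\<^sub>F t in nhds 0. G M \<phi> t \<ge> 0) \<and> comparable_root_graph M \<phi>"
    using comparable_root_graphI[OF k] by blast
qed

end
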